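(* Let $F$ be a coherent frame. The following are equivalent: (1) the spectral space $\mathrm{pt}(F)$ is Noetherian; (2) every element of $F$ is finite; (3) every prime element of $F$ is finite.
   Context: A frame is a complete lattice in which finite meets distribute over arbitrary joins; frame morphisms preserve arbitrary joins and finite meets. An element $x\in F$ is finite if whenever $x\le\bigvee S$ with $S\subseteq F$, there is a finite $K\subseteq S$ with $x\le\bigvee K$. $F$ is coherent if its finite elements are closed under finite joins and finite meets (including the top element) and every element of $F$ is a join of finite elements. An element $p\in F$ is prime if $p\ne 1$ and $x\wedge y\le p$ implies $x\le p$ or $y\le p$. $\mathrm{pt}(F)$ is the set of frame morphisms $f\colon F\to\{0,1\}$ with open subsets $U_y=\{f\mid f(y)=1\}$, $y\in F$; for $F$ coherent it is a spectral space. A topological space is Noetherian if every open subset is quasi-compact (equivalently, closed subsets satisfy the descending chain condition). *)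

theory Defs
  imports "HOL-Analysis.Analysis"
begin

class frame = complete_lattice +
  assumes inf_Sup_frame: "inf x (Sup S) = Sup (inf x ` S)"

instance bool :: frame
  by standard (simp only: inf_Sup)

text \<open>Finite meets include the empty one, so the top element is preserved.\<close>

definition frame_hom :: "('a::frame \<Rightarrow> 'b::frame) \<Rightarrow> bool" where
  "frame_hom f \<longleftrightarrow>
     (\<forall>S. f (Sup S) = Sup (f ` S)) \<and>
     (\<forall>K. finite K \<longrightarrow> f (Inf K) = Inf (f ` K))"

lemma frame_hom_Sup: "frame_hom f \<Longrightarrow> f (Sup S) = Sup (f ` S)"
  unfolding frame_hom_def by (elim conjE) (rule spec)

lemma frame_hom_Inf: "frame_hom f \<Longrightarrow> finite K \<Longrightarrow> f (Inf K) = Inf (f ` K)"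
  unfolding frame_hom_def by simp

lemma frame_hom_inf: "frame_hom f \<Longrightarrow> f (inf x y) = inf (f x) (f y)"
  using frame_hom_Inf[of f "{x, y}"] by simp

lemma frame_hom_top: "frame_hom f \<Longrightarrow> f top = top"
  using frame_hom_Inf[of f "{}"] by simp

definition (in complete_lattice) finite_element :: "'a \<Rightarrow> bool" where
  "finite_element x \<longleftrightarrow>
     (\<forall>S. x \<le> Sup S \<longrightarrow> (\<exists>K. finite K \<and> K \<subseteq> S \<and> x \<le> Sup K))"

definition (in complete_lattice) prime_element :: "'a \<Rightarrow> bool" where
  "prime_element p \<longleftrightarrow>
     p \<noteq> top \<and> (\<forall>x y. inf x y \<le> p \<longrightarrow> x \<le> p \<or> y \<le> p)"

text \<open>Taking \<open>K = {}\<close> in the second axiom makes the top element finite.\<close>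

class coherent_frame = frame +
  assumes finite_element_Sup:
      "finite K \<Longrightarrow> (\<forall>x\<in>K. finite_element x) \<Longrightarrow> finite_element (Sup K)"
    and finite_element_Inf:
      "finite K \<Longrightarrow> (\<forall>x\<in>K. finite_element x) \<Longrightarrow> finite_element (Inf K)"
    and Sup_of_finite_elements:
      "\<exists>S. (\<forall>s\<in>S. finite_element s) \<and> x = Sup S"

text \<open>The two-element frame \<open>{0, 1}\<close> is \<^typ>\<open>bool\<close>, with \<^term>\<open>True\<close> as \<open>1\<close>.\<close>

definition pt_open :: "'a::frame \<Rightarrow> ('a \<Rightarrow> bool) set" where
  "pt_open y = {f. frame_hom f \<and> f y = True}"

definition pt :: "('a::frame \<Rightarrow> bool) topology" where
  "pt = topology (\<lambda>U. \<exists>y. U = pt_open y)"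

lemma pt_open_Int: "pt_open x \<inter> pt_open y = pt_open (inf x y)"
  by (auto simp: pt_open_def frame_hom_inf)

lemma pt_open_Union: "\<Union> (pt_open ` Y) = pt_open (Sup Y)"
  by (auto simp: pt_open_def frame_hom_Sup)

lemma istopology_pt: "istopology (\<lambda>U. \<exists>y::'a::frame. U = pt_open y)"
  unfolding istopology_def
proof (intro conjI allI impI)
  fix U V :: "('a \<Rightarrow> bool) set"
  assume "\<exists>y. U = pt_open y" and "\<exists>y. V = pt_open y"
  then show "\<exists>y. U \<inter> V = pt_open y"
    by (elim exE) (simp only: pt_open_Int, rule exI, rule refl)
next
  fix \<U> :: "('a \<Rightarrow> bool) set set"
  assume "\<forall>U\<in>\<U>. \<exists>y. U = pt_open y"
  then have "\<U> \<subseteq> range pt_open" by blast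
  then obtain Y :: "'a set" where Y: "\<U> = pt_open ` Y" by (rule subset_imageE)
  show "\<exists>y. \<Union>\<U> = pt_open y"
    unfolding Y pt_open_Union by (rule exI, rule refl)
qed

lemma openin_pt: "openin pt U \<longleftrightarrow> (\<exists>y. U = pt_open y)"
  unfolding pt_def topology_inverse'[OF istopology_pt] ..

lemma topspace_pt: "topspace pt = {f. frame_hom f}"
proof -
  have "pt_open top = {f :: 'a \<Rightarrow> bool. frame_hom f}"
    by (auto simp: pt_open_def frame_hom_top)
  then show ?thesis
    unfolding topspace_def openin_pt by (auto simp: pt_open_def)
qed

definition noetherian_space :: "'a topology \<Rightarrow> bool" where
  "noetherian_space X \<longleftrightarrow> (\<forall>U. openin X U \<longrightarrow> compactin X U)"

end

theory Submission
  imports Defs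
begin

text \<open>
  Everything comes from one way of producing primes. If a set \<open>Q\<close> of elements of a frame contains
  \<open>top\<close>, is closed under binary meets and cannot be entered by taking the join of a chain outside
  \<open>Q\<close>, then by Zorn's lemma every element outside \<open>Q\<close> lies below one that is maximal outside \<open>Q\<close>,
  and distributivity makes such a maximal element prime (lemma \<open>prime_above_outside\<close>). The chain
  condition is a compactness property: a finite element below the join of a chain is already below
  a member of it (lemma \<open>finite_element_below_chain_member\<close>). Two choices of \<open>Q\<close> matter.

  For the principal filter \<open>{z. c \<le> z}\<close> of a finite element \<open>c\<close>, this gives primes that separate
  elements of a coherent frame. A prime \<open>p\<close> is the same thing as the point \<open>\<lambda>z. \<not> z \<le> p\<close>, so
  \<open>pt_open\<close> is an order embedding (lemma \<open>pt_open_subset_iff\<close>): the open sets of \<^term>\<open>pt\<close> form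
  a copy of the frame, and quasi-compactness of an open set is finiteness of the corresponding
  element. This is the equivalence between the Noetherian property and finiteness of all elements.

  For the set of finite elements itself, closed under finite meets in a coherent frame, it turns
  an element that is not finite into a prime that is not finite. Hence it suffices to test
  finiteness on primes.
\<close>

section \<open>Primes as maximal elements\<close>

lemma inf_sup_distrib_frame:
  fixes a b c :: "'a::frame"
  shows "inf a (sup b c) = sup (inf a b) (inf a c)"
  using inf_Sup_frame[of a "{b, c}"] by simp

lemma sup_inf_distrib_frame:
  fixes p a b :: "'a::frame"
  shows "inf (sup p a) (sup p b) = sup p (inf a b)"
proof -
  have "inf (sup p a) (sup p b) = sup (inf (sup p a) p) (inf (sup p a) b)"
    by (rule inf_sup_distrib_frame)
  also have "inf (sup p a) p = p"
    by (simp add: inf_absorb2)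
  also have "inf (sup p a) b = sup (inf p b) (inf a b)"
    using inf_sup_distrib_frame[of b p a] by (simp add: inf_commute)
  also have "sup p (sup (inf p b) (inf a b)) = sup p (inf a b)"
    by (simp add: sup_absorb1 flip: sup_assoc)
  finally show ?thesis .
qed

lemma Sup_finite_chain_mem:
  fixes K :: "'a::complete_lattice set"
  assumes "finite K" "K \<noteq> {}" "\<forall>x\<in>K. \<forall>y\<in>K. x \<le> y \<or> y \<le> x"
  shows "Sup K \<in> K"
  using assms
proof (induction K rule: finite_ne_induct)
  case (singleton x)
  then show ?case by simp
next
  case (insert x K)
  then have "Sup K \<in> K" by blast
  moreover from this insert.prems have "x \<le> Sup K \<or> Sup K \<le> x" by blast
  ultimately show ?case by (auto simp: sup_absorb1 sup_absorb2)
qed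

lemma finite_element_below_chain_member:
  fixes c :: "'a::complete_lattice"
  assumes c: "finite_element c" and ne: "C \<noteq> {}"
    and chain: "\<forall>x\<in>C. \<forall>y\<in>C. x \<le> y \<or> y \<le> x"
    and le: "c \<le> Sup C"
  shows "\<exists>z\<in>C. c \<le> z"
proof -
  obtain K where K: "finite K" "K \<subseteq> C" "c \<le> Sup K"
    using c le unfolding finite_element_def by blast
  obtain z where z: "z \<in> C" using ne by blast
  \<comment> \<open>The finite family supplied by the definition may be empty (if \<open>c\<close> is \<open>bot\<close>), so a member
    of \<open>C\<close> is added before the maximum is taken.\<close>
  have "Sup (insert z K) \<in> insert z K"
    using K z chain by (intro Sup_finite_chain_mem) blast+
  moreover have "c \<le> Sup (insert z K)"
    using K(3) by (simp add: le_supI2)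
  ultimately show ?thesis using K(2) z by (intro bexI[of _ "Sup (insert z K)"]) auto
qed

text \<open>
  Primality of a maximal element \<open>p\<close> outside \<open>Q\<close>: if neither \<open>a\<close> nor \<open>b\<close> is below \<open>p\<close>, both
  \<open>sup p a\<close> and \<open>sup p b\<close> are strictly larger than \<open>p\<close>, hence in \<open>Q\<close>, and so is their meet
  \<open>sup p (inf a b)\<close>; it therefore differs from \<open>p\<close>, which means that \<open>inf a b\<close> is not below \<open>p\<close>.
\<close>

lemma prime_above_outside:
  fixes y :: "'a::frame"
  assumes top: "top \<in> Q"
    and inf: "\<And>a b. a \<in> Q \<Longrightarrow> b \<in> Q \<Longrightarrow> inf a b \<in> Q"
    and chain: "\<And>C. C \<noteq> {} \<Longrightarrow> \<forall>x\<in>C. \<forall>y\<in>C. x \<le> y \<or> y \<le> x \<Longrightarrow> Sup C \<in> Q \<Longrightarrow> C \<inter> Q \<noteq> {}"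
    and y: "y \<notin> Q"
  obtains p where "prime_element p" "y \<le> p" "p \<notin> Q"
proof -
  define A where "A = {z. y \<le> z \<and> z \<notin> Q}"
  have "\<exists>m\<in>A. \<forall>a\<in>A. m \<le> a \<longrightarrow> a = m"
  proof (rule predicate_Zorn)
    show "partial_order_on A (relation_of (\<le>) A)"
      by (rule partial_order_on_relation_ofI) auto
  next
    fix C assume C: "C \<in> Chains (relation_of (\<le>) A)"
    then have lin: "\<forall>x\<in>C. \<forall>y\<in>C. x \<le> y \<or> y \<le> x" and sub: "C \<subseteq> A"
      by (auto simp: Chains_def relation_of_def)
    show "\<exists>u\<in>A. \<forall>a\<in>C. a \<le> u"
    proof (cases "C = {}")
      case True
      then show ?thesis using y by (auto simp: A_def)
    next
      case False
      then obtain z where "z \<in> C" by blast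
      then have "y \<le> Sup C"
        using sub by (auto simp: A_def intro: Sup_upper2)
      moreover have "Sup C \<notin> Q"
        using chain[OF False lin] sub by (auto simp: A_def)
      ultimately have "Sup C \<in> A" by (simp add: A_def)
      then show ?thesis by (auto intro: Sup_upper)
    qed
  qed
  then obtain p where p: "y \<le> p" "p \<notin> Q"
    and max: "\<And>a. y \<le> a \<Longrightarrow> a \<notin> Q \<Longrightarrow> p \<le> a \<Longrightarrow> a = p"
    unfolding A_def by blast
  have above: "sup p a \<in> Q" if "\<not> a \<le> p" for a
  proof (rule ccontr)
    assume "sup p a \<notin> Q"
    then have "sup p a = p"
      using p(1) by (intro max) (auto intro: le_supI1)
    with that show False by (metis sup_ge2)
  qed
  have "prime_element p"
    unfolding prime_element_def
  proof (intro conjI allI impI)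
    show "p \<noteq> top" using top p(2) by blast
  next
    fix a b assume ab: "inf a b \<le> p"
    show "a \<le> p \<or> b \<le> p"
    proof (rule ccontr)
      assume "\<not> (a \<le> p \<or> b \<le> p)"
      then have "inf (sup p a) (sup p b) \<in> Q" by (intro inf above) auto
      then have "p \<in> Q" using ab by (simp add: sup_inf_distrib_frame sup_absorb1)
      with p(2) show False ..
    qed
  qed
  with p that show thesis by blast
qed

section \<open>Points separate the elements of a coherent frame\<close>

lemma frame_hom_not_le_prime:
  fixes p :: "'a::frame"
  assumes "prime_element p"
  shows "frame_hom (\<lambda>z. \<not> z \<le> p)"
  unfolding frame_hom_def
proof (intro conjI allI impI)
  show "(\<not> Sup S \<le> p) = Sup ((\<lambda>z. \<not> z \<le> p) ` S)" for S
    by (auto simp: Sup_le_iff)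
next
  fix K :: "'a set" assume "finite K"
  then show "(\<not> Inf K \<le> p) = Inf ((\<lambda>z. \<not> z \<le> p) ` K)"
  proof (induction K rule: finite_induct)
    case empty
    then show ?case
      using assms by (auto simp: prime_element_def dest: top_le)
  next
    case (insert x K)
    have "inf x (Inf K) \<le> p \<longleftrightarrow> x \<le> p \<or> Inf K \<le> p"
      using assms by (auto simp: prime_element_def intro: le_infI1 le_infI2)
    with insert.IH show ?case by auto
  qed
qed

text \<open>
  When \<open>x\<close> is not below \<open>y\<close>, some finite element \<open>c\<close> below \<open>x\<close> is not below \<open>y\<close> either, because
  \<open>x\<close> is a join of finite elements. A prime above \<open>y\<close> outside the filter generated by \<open>c\<close> is then
  a point of \<open>x\<close> that is not a point of \<open>y\<close>.
\<close>

lemma pt_open_subset_iff: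
  fixes x y :: "'a::coherent_frame"
  shows "pt_open x \<subseteq> pt_open y \<longleftrightarrow> x \<le> y"
proof
  assume "x \<le> y"
  then have "inf x y = x" by (rule inf_absorb1)
  then show "pt_open x \<subseteq> pt_open y"
    using pt_open_Int[of x y] by auto
next
  assume sub: "pt_open x \<subseteq> pt_open y"
  show "x \<le> y"
  proof (rule ccontr)
    assume "\<not> x \<le> y"
    obtain S where S: "\<forall>s\<in>S. finite_element s" "x = Sup S"
      using Sup_of_finite_elements by blast
    with \<open>\<not> x \<le> y\<close> obtain c where c: "finite_element c" "c \<le> x" "\<not> c \<le> y"
      by (auto simp: Sup_le_iff intro: Sup_upper)
    obtain p where p: "prime_element p" "y \<le> p" "p \<notin> {z. c \<le> z}"
    proof (rule prime_above_outside[of "{z. c \<le> z}" y])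
      fix C assume "C \<noteq> {}" "\<forall>x\<in>C. \<forall>y\<in>C. x \<le> y \<or> y \<le> x" "Sup C \<in> {z. c \<le> z}"
      then show "C \<inter> {z. c \<le> z} \<noteq> {}"
        using finite_element_below_chain_member[OF c(1)] by blast
    qed (use c(3) in auto)
    have "\<not> x \<le> p" using c(2) p(3) by (auto dest: order_trans)
    then have "(\<lambda>z. \<not> z \<le> p) \<in> pt_open x"
      using frame_hom_not_le_prime[OF p(1)] by (simp add: pt_open_def)
    with sub have "\<not> y \<le> p" by (auto simp: pt_open_def)
    then show False using p(2) ..
  qed
qed

lemma compactin_pt_open_iff:
  fixes x :: "'a::coherent_frame"
  shows "compactin pt (pt_open x) \<longleftrightarrow> finite_element x"
proof -
  have opens: "(\<forall>U\<in>\<U>. openin pt U) \<longleftrightarrow> (\<exists>S::'a set. \<U> = pt_open ` S)" for \<U>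
  proof -
    have "(\<forall>U\<in>\<U>. openin pt U) \<longleftrightarrow> \<U> \<subseteq> range pt_open"
      by (auto simp: openin_pt)
    also have "\<dots> \<longleftrightarrow> (\<exists>S::'a set. \<U> = pt_open ` S)"
      by (simp add: subset_image_iff)
    finally show ?thesis .
  qed
  have cover: "pt_open x \<subseteq> \<Union> (pt_open ` S) \<longleftrightarrow> x \<le> Sup S" for S
    by (simp only: pt_open_Union pt_open_subset_iff)
  have "pt_open x \<subseteq> topspace pt"
    by (auto simp: topspace_pt pt_open_def)
  then have "compactin pt (pt_open x) \<longleftrightarrow>
      (\<forall>\<U>. (\<exists>S::'a set. \<U> = pt_open ` S) \<longrightarrow> pt_open x \<subseteq> \<Union> \<U> \<longrightarrow>
        (\<exists>\<F>. finite \<F> \<and> \<F> \<subseteq> \<U> \<and> pt_open x \<subseteq> \<Union> \<F>))"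
    unfolding compactin_def opens by blast
  also have "\<dots> \<longleftrightarrow> (\<forall>S. pt_open x \<subseteq> \<Union> (pt_open ` S) \<longrightarrow>
      (\<exists>\<F>. finite \<F> \<and> \<F> \<subseteq> pt_open ` S \<and> pt_open x \<subseteq> \<Union> \<F>))"
    by blast
  also have "\<dots> \<longleftrightarrow> (\<forall>S. pt_open x \<subseteq> \<Union> (pt_open ` S) \<longrightarrow>
      (\<exists>K. finite K \<and> K \<subseteq> S \<and> pt_open x \<subseteq> \<Union> (pt_open ` K)))"
    by (simp only: ex_finite_subset_image)
  also have "\<dots> \<longleftrightarrow> finite_element x"
    by (simp only: cover finite_element_def)
  finally show ?thesis .
qed

section \<open>Finiteness is detected by primes\<close>

text \<open>
  The chain condition for \<open>Q\<close> the set of finite elements holds because the join of a chain,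
  if it is a finite element, lies below a member of the chain and hence equals it.
\<close>

lemma finite_elements_if_primes_finite:
  fixes x :: "'a::coherent_frame"
  assumes primes: "\<And>p::'a. prime_element p \<Longrightarrow> finite_element p"
  shows "finite_element x"
proof (rule ccontr)
  assume "\<not> finite_element x"
  obtain p :: 'a where "prime_element p" "p \<notin> Collect finite_element"
  proof (rule prime_above_outside[of "Collect finite_element" x])
    show "(top::'a) \<in> Collect finite_element"
      using finite_element_Inf[of "{}::'a set"] by simp
  next
    fix a b :: 'a
    assume "a \<in> Collect finite_element" "b \<in> Collect finite_element"
    then show "inf a b \<in> Collect finite_element"
      using finite_element_Inf[of "{a, b}"] by simp
  next
    fix C :: "'a set"
    assume C: "C \<noteq> {}" "\<forall>x\<in>C. \<forall>y\<in>C. x \<le> y \<or> y \<le> x" "Sup C \<in> Collect finite_element"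
    then obtain z where "z \<in> C" "Sup C \<le> z"
      using finite_element_below_chain_member[of "Sup C" C] by auto
    then have "Sup C \<in> C" using Sup_upper[of z C] by (simp add: antisym)
    with C(3) show "C \<inter> Collect finite_element \<noteq> {}" by blast
  qed (use \<open>\<not> finite_element x\<close> in auto)
  with primes show False by simp
qed

theorem theorem2:
  shows "(noetherian_space (pt :: ('a::coherent_frame \<Rightarrow> bool) topology)
            \<longleftrightarrow> (\<forall>x::'a. finite_element x))
       \<and> ((\<forall>x::'a. finite_element x)
            \<longleftrightarrow> (\<forall>p::'a. prime_element p \<longrightarrow> finite_element p))"
proof
  show "noetherian_space (pt :: ('a \<Rightarrow> bool) topology) \<longleftrightarrow> (\<forall>x::'a. finite_element x)"
    unfolding noetherian_space_def openin_pt using compactin_pt_open_iff by blast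
next
  show "(\<forall>x::'a. finite_element x) \<longleftrightarrow> (\<forall>p::'a. prime_element p \<longrightarrow> finite_element p)"
    using finite_elements_if_primes_finite by blast
qed

end
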